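(* Let $G$ be a $!$-graph and $b \in {!}(G)$. Then the $\mathcal{G}_{T!}$-typed graphs $\mathrm{COPY}_b(G)$, $\mathrm{DROP}_b(G)$ and $\mathrm{KILL}_b(G)$ are all $!$-graphs.
   Context: Fix a compressed monoidal signature $T=(O,M,\mathrm{dom},\mathrm{cod})$, $\mathrm{dom},\mathrm{cod}: M \rightarrow (O\times\{\mathsf{v},\mathsf{f}\})^*$. The derived compressed typegraph $\mathcal{G}_T$ has vertex set $O\sqcup M$, a self-loop on each $X\in O$, an edge $\mathrm{in}^a_{f,i}$ from $X$ to $f$ for each $f\in M$ and index $i$ with $\mathrm{dom}(f)[i]=(X,a)$, and an edge $\mathrm{out}^a_{f,j}$ from $f$ to $X$ for each index $j$ with $\mathrm{cod}(f)[j]=(X,a)$. $\mathcal{G}_{T!}$ is $\mathcal{G}_T$ plus a vertex $!$, a self-loop on $!$, and an edge from $!$ to each vertex of $\mathcal{G}_T$. For a finite directed multigraph $G$ typed over $\mathcal{G}_{T!}$, vertices typed in $O$, $M$, $!$ are wire-, node-, $!$-vertices ($!(G)$ the set of $!$-vertices); fixed-arity edges are those typed by an $\mathsf{f}$-tagged edge; $U(G)$ deletes $!$-vertices and incident edges. A string graph is a $\mathcal{G}_T$-typed graph whose typing restricts at each node-vertex to a bijection on incident fixed-arity edges and whose wire-vertices have at most one incoming and one outgoing edge. An open subgraph $O'$ of a string graph $K$ is a string subgraph with no vertex adjacent to a wire-vertex outside $O'$ and no incident fixed-arity edge outside $O'$. $B(b)$ is the full subgraph on successors of a $!$-vertex $b$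 (vertices $v$ with an edge $b \rightarrow v$; by reflexivity $b \in B(b)$), $\beta(G)$ the full subgraph on $!$-vertices. A $!$-graph is a $\mathcal{G}_{T!}$-typed graph with $U(G)$ a string graph, $\beta(G)$ posetal (at most one edge between two vertices, edge relation a partial order), $U(B(b))$ open in $U(G)$ for each $!$-vertex $b$, and $B(b')\subseteq B(b)$ whenever $b'\in B(b)$. For a subgraph $H$ of $G$, $G\setminus H$ denotes the full subgraph of $G$ on the vertices not in $H$. The $!$-box operations are: $\mathrm{COPY}_b(G)$ is the pushout in $\mathbf{Graph}/\mathcal{G}_{T!}$ of the span $G \hookleftarrow G\setminus B(b) \hookrightarrow G$ of two copies of the inclusion; $\mathrm{DROP}_b(G) = G \setminus \{b\}$; $\mathrm{KILL}_b(G) = G\setminus B(b)$. *)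

theory Defs
  imports "Graph_Theory.Digraph_Component"
begin

section \<open>Compressed monoidal signatures and their typegraphs\<close>

datatype arity = VarArity | FixArity

record ('o, 'm) signature =
  objs :: "'o set"
  mors :: "'m set"
  sdom :: "'m \<Rightarrow> ('o \<times> arity) list"
  scod :: "'m \<Rightarrow> ('o \<times> arity) list"

definition compressed_signature :: "('o, 'm) signature \<Rightarrow> bool" where
  "compressed_signature T \<longleftrightarrow>
     (\<forall>f \<in> mors T. set (sdom T f) \<subseteq> objs T \<times> UNIV \<and> set (scod T f) \<subseteq> objs T \<times> UNIV)"

datatype ('o, 'm) tvert = Obj 'o | Mor 'm | Bang

text \<open>
  The edge \<open>BangTo x\<close> is the edge from the vertex \<open>!\<close> to \<open>x\<close>; in particular
  \<open>BangTo Bang\<close> is the self-loop on \<open>!\<close>.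
\<close>

datatype ('o, 'm) tedge =
    Loop 'o
  | InE arity 'm nat
  | OutE arity 'm nat
  | BangTo "('o, 'm) tvert"

primrec te_tail :: "('o, 'm) signature \<Rightarrow> ('o, 'm) tedge \<Rightarrow> ('o, 'm) tvert" where
  "te_tail T (Loop X) = Obj X"
| "te_tail T (InE a f i) = Obj (fst (sdom T f ! i))"
| "te_tail T (OutE a f j) = Mor f"
| "te_tail T (BangTo x) = Bang"

primrec te_head :: "('o, 'm) signature \<Rightarrow> ('o, 'm) tedge \<Rightarrow> ('o, 'm) tvert" where
  "te_head T (Loop X) = Obj X"
| "te_head T (InE a f i) = Mor f"
| "te_head T (OutE a f j) = Obj (fst (scod T f ! j))"
| "te_head T (BangTo x) = x"

definition typegraph :: "('o, 'm) signature \<Rightarrow> (('o, 'm) tvert, ('o, 'm) tedge) pre_digraph" where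
  "typegraph T = \<lparr>
     verts = Obj ` objs T \<union> Mor ` mors T,
     arcs = Loop ` objs T
       \<union> {InE a f i | a f i. f \<in> mors T \<and> i < length (sdom T f) \<and> snd (sdom T f ! i) = a}
       \<union> {OutE a f j | a f j. f \<in> mors T \<and> j < length (scod T f) \<and> snd (scod T f ! j) = a},
     tail = te_tail T,
     head = te_head T \<rparr>"

definition bang_typegraph ::
    "('o, 'm) signature \<Rightarrow> (('o, 'm) tvert, ('o, 'm) tedge) pre_digraph" where
  "bang_typegraph T = \<lparr>
     verts = insert Bang (verts (typegraph T)),
     arcs = arcs (typegraph T) \<union> BangTo ` insert Bang (verts (typegraph T)),
     tail = te_tail T,
     head = te_head T \<rparr>"

fun fixed_tedge :: "('o, 'm) tedge \<Rightarrow> bool" where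
  "fixed_tedge (InE FixArity f i) = True"
| "fixed_tedge (OutE FixArity f j) = True"
| "fixed_tedge _ = False"

lemma signature_obj:
  assumes "compressed_signature T" "f \<in> mors T"
  shows "i < length (sdom T f) \<Longrightarrow> fst (sdom T f ! i) \<in> objs T"
    and "j < length (scod T f) \<Longrightarrow> fst (scod T f ! j) \<in> objs T"
proof -
  have *: "set (sdom T f) \<subseteq> objs T \<times> UNIV" "set (scod T f) \<subseteq> objs T \<times> UNIV"
    using assms by (auto simp: compressed_signature_def)
  show "fst (sdom T f ! i) \<in> objs T" if "i < length (sdom T f)"
    using subsetD[OF *(1) nth_mem[OF that]] by (simp add: mem_Times_iff)
  show "fst (scod T f ! j) \<in> objs T" if "j < length (scod T f)"
    using subsetD[OF *(2) nth_mem[OF that]] by (simp add: mem_Times_iff)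
qed

lemma wf_typegraph: "compressed_signature T \<Longrightarrow> wf_digraph (typegraph T)"
  by unfold_locales (auto simp: typegraph_def signature_obj)

lemma wf_bang_typegraph: "compressed_signature T \<Longrightarrow> wf_digraph (bang_typegraph T)"
  by unfold_locales (auto simp: bang_typegraph_def typegraph_def signature_obj)


section \<open>Typed graphs\<close>

record ('v, 'e, 'o, 'm) typed_graph =
  shape :: "('v, 'e) pre_digraph"
  vtype :: "'v \<Rightarrow> ('o, 'm) tvert"
  etype :: "'e \<Rightarrow> ('o, 'm) tedge"

text \<open>
  The objects of the slice category over a typegraph \<open>TG\<close>; finiteness is imposed separately,
  in the definitions of string graphs and \<open>!\<close>-graphs.
\<close>

definition typed_over ::
    "(('o, 'm) tvert, ('o, 'm) tedge) pre_digraph \<Rightarrow> ('v, 'e, 'o, 'm) typed_graph \<Rightarrow> bool" where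
  "typed_over TG G \<longleftrightarrow> wf_digraph (shape G) \<and>
     (\<forall>v \<in> verts (shape G). vtype G v \<in> verts TG) \<and>
     (\<forall>e \<in> arcs (shape G). etype G e \<in> arcs TG \<and>
        tail TG (etype G e) = vtype G (tail (shape G) e) \<and>
        head TG (etype G e) = vtype G (head (shape G) e))"

definition typed_hom :: "('v, 'e, 'o, 'm) typed_graph \<Rightarrow> ('w, 'd, 'o, 'm) typed_graph \<Rightarrow>
    ('v \<Rightarrow> 'w) \<Rightarrow> ('e \<Rightarrow> 'd) \<Rightarrow> bool" where
  "typed_hom G H hV hE \<longleftrightarrow>
     (\<forall>v \<in> verts (shape G). hV v \<in> verts (shape H) \<and> vtype H (hV v) = vtype G v) \<and>
     (\<forall>e \<in> arcs (shape G). hE e \<in> arcs (shape H) \<and> etype H (hE e) = etype G e \<and>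
        tail (shape H) (hE e) = hV (tail (shape G) e) \<and>
        head (shape H) (hE e) = hV (head (shape G) e))"

definition typed_subgraph ::
    "('v, 'e, 'o, 'm) typed_graph \<Rightarrow> ('v, 'e, 'o, 'm) typed_graph \<Rightarrow> bool" where
  "typed_subgraph H G \<longleftrightarrow> subgraph (shape H) (shape G) \<and>
     (\<forall>v \<in> verts (shape H). vtype H v = vtype G v) \<and>
     (\<forall>e \<in> arcs (shape H). etype H e = etype G e)"

definition full_subgraph ::
    "('v, 'e, 'o, 'm) typed_graph \<Rightarrow> 'v set \<Rightarrow> ('v, 'e, 'o, 'm) typed_graph" where
  "full_subgraph G S = G\<lparr>shape := shape G \<restriction> (verts (shape G) \<inter> S)\<rparr>"

definition remove_verts ::
    "('v, 'e, 'o, 'm) typed_graph \<Rightarrow> 'v set \<Rightarrow> ('v, 'e, 'o, 'm) typed_graph" where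
  "remove_verts G S = full_subgraph G (verts (shape G) - S)"

lemma full_subgraph_typed:
  assumes "typed_over TG G"
  shows "typed_over TG (full_subgraph G S)" and "typed_hom (full_subgraph G S) G id id"
  using assms
  by (auto simp: typed_over_def typed_hom_def full_subgraph_def wf_digraph_def induce_subgraph_def)

definition wire_verts :: "('v, 'e, 'o, 'm) typed_graph \<Rightarrow> 'v set" where
  "wire_verts G = {v \<in> verts (shape G). \<exists>X. vtype G v = Obj X}"

definition node_verts :: "('v, 'e, 'o, 'm) typed_graph \<Rightarrow> 'v set" where
  "node_verts G = {v \<in> verts (shape G). \<exists>f. vtype G v = Mor f}"

definition bang_verts :: "('v, 'e, 'o, 'm) typed_graph \<Rightarrow> 'v set" where
  "bang_verts G = {v \<in> verts (shape G). vtype G v = Bang}"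

definition incident_arcs :: "('v, 'e) pre_digraph \<Rightarrow> 'v \<Rightarrow> 'e set" where
  "incident_arcs D v = in_arcs D v \<union> out_arcs D v"

definition fixed_incident :: "('v, 'e, 'o, 'm) typed_graph \<Rightarrow> 'v \<Rightarrow> 'e set" where
  "fixed_incident G v = {e \<in> incident_arcs (shape G) v. fixed_tedge (etype G e)}"


section \<open>String graphs and \<open>!\<close>-graphs\<close>

definition string_graph :: "('o, 'm) signature \<Rightarrow> ('v, 'e, 'o, 'm) typed_graph \<Rightarrow> bool" where
  "string_graph T G \<longleftrightarrow> fin_digraph (shape G) \<and> typed_over (typegraph T) G \<and>
     (\<forall>n \<in> node_verts G. bij_betw (etype G) (fixed_incident G n)
        {t \<in> incident_arcs (typegraph T) (vtype G n). fixed_tedge t}) \<and>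
     (\<forall>w \<in> wire_verts G. in_degree (shape G) w \<le> 1 \<and> out_degree (shape G) w \<le> 1)"

definition open_subgraph :: "('o, 'm) signature \<Rightarrow>
    ('v, 'e, 'o, 'm) typed_graph \<Rightarrow> ('v, 'e, 'o, 'm) typed_graph \<Rightarrow> bool" where
  "open_subgraph T H K \<longleftrightarrow> typed_subgraph H K \<and> string_graph T H \<and>
     (\<forall>v \<in> verts (shape H). \<forall>w \<in> wire_verts K - verts (shape H).
        \<not> v \<rightarrow>\<^bsub>shape K\<^esub> w \<and> \<not> w \<rightarrow>\<^bsub>shape K\<^esub> v) \<and>
     (\<forall>v \<in> verts (shape H). fixed_incident K v \<subseteq> arcs (shape H))"

text \<open>\<open>U_graph\<close>, \<open>beta_graph\<close> and \<open>B_graph\<close> are the usual \<open>U(G)\<close>, \<open>\<beta>(G)\<close> and \<open>B(b)\<close>.\<close>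

definition U_graph :: "('v, 'e, 'o, 'm) typed_graph \<Rightarrow> ('v, 'e, 'o, 'm) typed_graph" where
  "U_graph G = remove_verts G (bang_verts G)"

definition beta_graph :: "('v, 'e, 'o, 'm) typed_graph \<Rightarrow> ('v, 'e, 'o, 'm) typed_graph" where
  "beta_graph G = full_subgraph G (bang_verts G)"

definition B_graph :: "('v, 'e, 'o, 'm) typed_graph \<Rightarrow> 'v \<Rightarrow> ('v, 'e, 'o, 'm) typed_graph" where
  "B_graph G b = full_subgraph G {v. b \<rightarrow>\<^bsub>shape G\<^esub> v}"

definition posetal :: "('v, 'e) pre_digraph \<Rightarrow> bool" where
  "posetal D \<longleftrightarrow> nomulti_digraph D \<and> partial_order_on (verts D) (arcs_ends D)"

definition bang_graph :: "('o, 'm) signature \<Rightarrow> ('v, 'e, 'o, 'm) typed_graph \<Rightarrow> bool" where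
  "bang_graph T G \<longleftrightarrow> fin_digraph (shape G) \<and> typed_over (bang_typegraph T) G \<and>
     string_graph T (U_graph G) \<and>
     posetal (shape (beta_graph G)) \<and>
     (\<forall>b \<in> bang_verts G. open_subgraph T (U_graph (B_graph G b)) (U_graph G)) \<and>
     (\<forall>b \<in> bang_verts G. \<forall>b' \<in> bang_verts (B_graph G b).
        typed_subgraph (B_graph G b') (B_graph G b))"


section \<open>Pushouts of typed graphs\<close>

text \<open>
  The pushout of a span \<open>A \<leftarrow> C \<rightarrow> B\<close> in the slice category, computed componentwise on
  vertices and edges as the quotient of the disjoint union by the equivalence relation that
  \<open>f c \<sim> g c\<close> generates.
\<close>

definition glue_rel :: "'c set \<Rightarrow> ('c \<Rightarrow> 'a) \<Rightarrow> ('c \<Rightarrow> 'b) \<Rightarrow> ('a + 'b) rel" where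
  "glue_rel C f g = (let r = (\<lambda>c. (Inl (f c), Inr (g c))) ` C in (r \<union> r\<inverse>)\<^sup>*)"

text \<open>
  All tails of members of an edge class are equivalent, so the image of the set of these tails
  under the equivalence relation is a single vertex class; likewise for heads. All members of a
  class have the same type.
\<close>

definition pushout_graph ::
    "('u, 'c, 'o, 'm) typed_graph \<Rightarrow> ('v, 'e, 'o, 'm) typed_graph \<Rightarrow> ('w, 'd, 'o, 'm) typed_graph \<Rightarrow>
     ('u \<Rightarrow> 'v) \<Rightarrow> ('c \<Rightarrow> 'e) \<Rightarrow> ('u \<Rightarrow> 'w) \<Rightarrow> ('c \<Rightarrow> 'd) \<Rightarrow>
     (('v + 'w) set, ('e + 'd) set, 'o, 'm) typed_graph" where
  "pushout_graph C A B fV fE gV gE = (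
     let RV = glue_rel (verts (shape C)) fV gV;
         RE = glue_rel (arcs (shape C)) fE gE
     in \<lparr> shape = \<lparr>
            verts = (verts (shape A) <+> verts (shape B)) // RV,
            arcs = (arcs (shape A) <+> arcs (shape B)) // RE,
            tail = (\<lambda>c. RV `` (map_sum (tail (shape A)) (tail (shape B)) ` c)),
            head = (\<lambda>c. RV `` (map_sum (head (shape A)) (head (shape B)) ` c)) \<rparr>,
          vtype = (\<lambda>c. the_elem (case_sum (vtype A) (vtype B) ` c)),
          etype = (\<lambda>c. the_elem (case_sum (etype A) (etype B) ` c)) \<rparr>)"

lemma glue_rel_respects:
  assumes "(x, y) \<in> glue_rel C f g" and "\<And>c. c \<in> C \<Longrightarrow> F (Inl (f c)) = F (Inr (g c))"
  shows "F x = F y"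
  using assms(1) unfolding glue_rel_def Let_def
  by (induction rule: rtrancl_induct) (auto simp: assms(2))

lemma glue_rel_refl: "(x, x) \<in> glue_rel C f g"
  by (simp add: glue_rel_def Let_def)

lemma glue_rel_equiv: "equiv UNIV (glue_rel C f g)"
  unfolding glue_rel_def Let_def
  by (intro equivI refl_rtrancl sym_rtrancl trans_rtrancl) (auto simp: sym_def)

lemma glue_rel_glue:
  "c \<in> C \<Longrightarrow> glue_rel C f g `` {Inl (f c)} = glue_rel C f g `` {Inr (g c)}"
  by (intro equiv_class_eq[OF glue_rel_equiv]) (auto simp: glue_rel_def Let_def)

lemma glue_rel_image:
  assumes "\<And>c. c \<in> C \<Longrightarrow> F (Inl (f c)) = F (Inr (g c))"
  shows "F ` (glue_rel C f g `` {x}) = {F x}"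
proof -
  have "F y = F x" if "(x, y) \<in> glue_rel C f g" for y
    using glue_rel_respects[where F = F, OF that assms] by simp
  then have "F ` (glue_rel C f g `` {x}) \<subseteq> {F x}" by blast
  moreover have "F x \<in> F ` (glue_rel C f g `` {x})" using glue_rel_refl[of x C f g] by blast
  ultimately show ?thesis by blast
qed

lemma glue_rel_end:
  assumes "\<And>c. c \<in> C \<Longrightarrow> R `` {h (Inl (f c))} = R `` {h (Inr (g c))}"
  shows "R `` (h ` (glue_rel C f g `` {x})) = R `` {h x}"
proof -
  have "R `` (h ` S) = \<Union> ((\<lambda>y. R `` {h y}) ` S)" for S by auto
  then show ?thesis
    using glue_rel_image[where F = "\<lambda>y. R `` {h y}" and C = C and f = f and g = g and x = x] assms
    by simp
qed

lemma pushout_graph_universal: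
  fixes C :: "('u, 'c, 'o, 'm) typed_graph"
    and A :: "('v, 'e, 'o, 'm) typed_graph"
    and B :: "('w, 'd, 'o, 'm) typed_graph"
    and Q :: "('x, 'y, 'o, 'm) typed_graph"
  assumes C: "typed_over TG C" and A: "typed_over TG A" and B: "typed_over TG B"
    and f: "typed_hom C A fV fE" and g: "typed_hom C B gV gE"
  defines "P \<equiv> pushout_graph C A B fV fE gV gE"
    and "iV \<equiv> \<lambda>v. glue_rel (verts (shape C)) fV gV `` {Inl v}"
    and "iE \<equiv> \<lambda>e. glue_rel (arcs (shape C)) fE gE `` {Inl e}"
    and "jV \<equiv> \<lambda>w. glue_rel (verts (shape C)) fV gV `` {Inr w}"
    and "jE \<equiv> \<lambda>d. glue_rel (arcs (shape C)) fE gE `` {Inr d}"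
  shows "typed_over TG P"
    and "typed_hom A P iV iE"
    and "typed_hom B P jV jE"
    and "\<And>v. v \<in> verts (shape C) \<Longrightarrow> iV (fV v) = jV (gV v)"
    and "\<And>e. e \<in> arcs (shape C) \<Longrightarrow> iE (fE e) = jE (gE e)"
    and "\<forall>hV hE kV kE.
       typed_over TG Q \<and> typed_hom A Q hV hE \<and> typed_hom B Q kV kE \<and>
       (\<forall>v \<in> verts (shape C). hV (fV v) = kV (gV v)) \<and>
       (\<forall>e \<in> arcs (shape C). hE (fE e) = kE (gE e)) \<longrightarrow>
       (\<exists>uV uE. typed_hom P Q uV uE \<and>
         (\<forall>v \<in> verts (shape A). uV (iV v) = hV v) \<and> (\<forall>e \<in> arcs (shape A). uE (iE e) = hE e) \<and>
         (\<forall>v \<in> verts (shape B). uV (jV v) = kV v) \<and> (\<forall>e \<in> arcs (shape B). uE (jE e) = kE e) \<and>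
         (\<forall>uV' uE'. typed_hom P Q uV' uE' \<and>
           (\<forall>v \<in> verts (shape A). uV' (iV v) = hV v) \<and> (\<forall>e \<in> arcs (shape A). uE' (iE e) = hE e) \<and>
           (\<forall>v \<in> verts (shape B). uV' (jV v) = kV v) \<and> (\<forall>e \<in> arcs (shape B). uE' (jE e) = kE e)
           \<longrightarrow> (\<forall>v \<in> verts (shape P). uV' v = uV v) \<and> (\<forall>e \<in> arcs (shape P). uE' e = uE e)))"
proof -
  let ?RV = "glue_rel (verts (shape C)) fV gV" and ?RE = "glue_rel (arcs (shape C)) fE gE"
  have wfC: "tail (shape C) c \<in> verts (shape C)" "head (shape C) c \<in> verts (shape C)"
    if "c \<in> arcs (shape C)" for c
    using C that by (auto simp: typed_over_def wf_digraph_def)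
  have PV: "verts (shape P) = iV ` verts (shape A) \<union> jV ` verts (shape B)"
    by (auto simp: P_def pushout_graph_def Let_def quotient_def iV_def jV_def)
  have PE: "arcs (shape P) = iE ` arcs (shape A) \<union> jE ` arcs (shape B)"
    by (auto simp: P_def pushout_graph_def Let_def quotient_def iE_def jE_def)
  show glueV: "iV (fV v) = jV (gV v)" if "v \<in> verts (shape C)" for v
    unfolding iV_def jV_def by (rule glue_rel_glue[OF that])
  show glueE: "iE (fE e) = jE (gE e)" if "e \<in> arcs (shape C)" for e
    unfolding iE_def jE_def by (rule glue_rel_glue[OF that])
  have tl: "tail (shape P) (?RE `` {x}) = ?RV `` {map_sum (tail (shape A)) (tail (shape B)) x}" for x
  proof -
    have "?RV `` {map_sum (tail (shape A)) (tail (shape B)) (Inl (fE c))}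
        = ?RV `` {map_sum (tail (shape A)) (tail (shape B)) (Inr (gE c))}"
      if "c \<in> arcs (shape C)" for c
      using f g that glue_rel_glue[OF wfC(1)[OF that], of fV gV] by (auto simp: typed_hom_def)
    from glue_rel_end[OF this] show ?thesis by (simp add: P_def pushout_graph_def Let_def)
  qed
  have hd: "head (shape P) (?RE `` {x}) = ?RV `` {map_sum (head (shape A)) (head (shape B)) x}" for x
  proof -
    have "?RV `` {map_sum (head (shape A)) (head (shape B)) (Inl (fE c))}
        = ?RV `` {map_sum (head (shape A)) (head (shape B)) (Inr (gE c))}"
      if "c \<in> arcs (shape C)" for c
      using f g that glue_rel_glue[OF wfC(2)[OF that], of fV gV] by (auto simp: typed_hom_def)
    from glue_rel_end[OF this] show ?thesis by (simp add: P_def pushout_graph_def Let_def)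
  qed
  have vt: "vtype P (?RV `` {x}) = case_sum (vtype A) (vtype B) x" for x
  proof -
    have "case_sum (vtype A) (vtype B) (Inl (fV c)) = case_sum (vtype A) (vtype B) (Inr (gV c))"
      if "c \<in> verts (shape C)" for c
      using f g that by (auto simp: typed_hom_def)
    then have "case_sum (vtype A) (vtype B) ` (?RV `` {x}) = {case_sum (vtype A) (vtype B) x}"
      by (rule glue_rel_image)
    then show ?thesis by (simp add: P_def pushout_graph_def Let_def)
  qed
  have et: "etype P (?RE `` {x}) = case_sum (etype A) (etype B) x" for x
  proof -
    have "case_sum (etype A) (etype B) (Inl (fE c)) = case_sum (etype A) (etype B) (Inr (gE c))"
      if "c \<in> arcs (shape C)" for c
      using f g that by (auto simp: typed_hom_def)
    then have "case_sum (etype A) (etype B) ` (?RE `` {x}) = {case_sum (etype A) (etype B) x}"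
      by (rule glue_rel_image)
    then show ?thesis by (simp add: P_def pushout_graph_def Let_def)
  qed
  have tlI: "tail (shape P) (iE e) = iV (tail (shape A) e)" for e by (simp add: tl iE_def iV_def)
  have tlJ: "tail (shape P) (jE e) = jV (tail (shape B) e)" for e by (simp add: tl jE_def jV_def)
  have hdI: "head (shape P) (iE e) = iV (head (shape A) e)" for e by (simp add: hd iE_def iV_def)
  have hdJ: "head (shape P) (jE e) = jV (head (shape B) e)" for e by (simp add: hd jE_def jV_def)
  have vtI: "vtype P (iV v) = vtype A v" for v by (simp add: vt iV_def)
  have vtJ: "vtype P (jV v) = vtype B v" for v by (simp add: vt jV_def)
  have etI: "etype P (iE v) = etype A v" for v by (simp add: et iE_def)
  have etJ: "etype P (jE v) = etype B v" for v by (simp add: et jE_def)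
  note P_simps = PV PE tlI tlJ hdI hdJ vtI vtJ etI etJ
  show "typed_over TG P"
    using A B by (auto simp: typed_over_def wf_digraph_def P_simps)
  show "typed_hom A P iV iE" "typed_hom B P jV jE"
    by (auto simp: typed_hom_def P_simps)
  have univ: "\<exists>uV uE. typed_hom P Q uV uE \<and>
         (\<forall>v \<in> verts (shape A). uV (iV v) = hV v) \<and> (\<forall>e \<in> arcs (shape A). uE (iE e) = hE e) \<and>
         (\<forall>v \<in> verts (shape B). uV (jV v) = kV v) \<and> (\<forall>e \<in> arcs (shape B). uE (jE e) = kE e) \<and>
         (\<forall>uV' uE'. typed_hom P Q uV' uE' \<and>
           (\<forall>v \<in> verts (shape A). uV' (iV v) = hV v) \<and> (\<forall>e \<in> arcs (shape A). uE' (iE e) = hE e) \<and>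
           (\<forall>v \<in> verts (shape B). uV' (jV v) = kV v) \<and> (\<forall>e \<in> arcs (shape B). uE' (jE e) = kE e)
           \<longrightarrow> (\<forall>v \<in> verts (shape P). uV' v = uV v) \<and> (\<forall>e \<in> arcs (shape P). uE' e = uE e))"
    if h: "typed_hom A Q hV hE" and k: "typed_hom B Q kV kE"
      and cV: "\<forall>v \<in> verts (shape C). hV (fV v) = kV (gV v)"
      and cE: "\<forall>e \<in> arcs (shape C). hE (fE e) = kE (gE e)" for hV hE kV kE
  proof -
    define uV where "uV X = the_elem (case_sum hV kV ` X)" for X
    define uE where "uE X = the_elem (case_sum hE kE ` X)" for X
    have V: "uV (?RV `` {x}) = case_sum hV kV x" for x
      using glue_rel_image[of "verts (shape C)" "case_sum hV kV" fV gV x] cV by (simp add: uV_def)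
    have E: "uE (?RE `` {x}) = case_sum hE kE x" for x
      using glue_rel_image[of "arcs (shape C)" "case_sum hE kE" fE gE x] cE by (simp add: uE_def)
    have u: "uV (iV v) = hV v" "uV (jV w) = kV w" "uE (iE e) = hE e" "uE (jE d) = kE d" for v w e d
      by (simp_all add: V E iV_def iE_def jV_def jE_def)
    have "typed_hom P Q uV uE"
      using h k by (auto simp: typed_hom_def P_simps u)
    moreover have "\<forall>uV' uE'. typed_hom P Q uV' uE' \<and>
        (\<forall>v \<in> verts (shape A). uV' (iV v) = hV v) \<and> (\<forall>e \<in> arcs (shape A). uE' (iE e) = hE e) \<and>
        (\<forall>v \<in> verts (shape B). uV' (jV v) = kV v) \<and> (\<forall>e \<in> arcs (shape B). uE' (jE e) = kE e)
        \<longrightarrow> (\<forall>v \<in> verts (shape P). uV' v = uV v) \<and> (\<forall>e \<in> arcs (shape P). uE' e = uE e)"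
      by (auto simp: PV PE u)
    ultimately show ?thesis
      using u by (intro exI[of _ uV] exI[of _ uE] conjI) simp_all
  qed
  show "\<forall>hV hE kV kE.
       typed_over TG Q \<and> typed_hom A Q hV hE \<and> typed_hom B Q kV kE \<and>
       (\<forall>v \<in> verts (shape C). hV (fV v) = kV (gV v)) \<and>
       (\<forall>e \<in> arcs (shape C). hE (fE e) = kE (gE e)) \<longrightarrow>
       (\<exists>uV uE. typed_hom P Q uV uE \<and>
         (\<forall>v \<in> verts (shape A). uV (iV v) = hV v) \<and> (\<forall>e \<in> arcs (shape A). uE (iE e) = hE e) \<and>
         (\<forall>v \<in> verts (shape B). uV (jV v) = kV v) \<and> (\<forall>e \<in> arcs (shape B). uE (jE e) = kE e) \<and>
         (\<forall>uV' uE'. typed_hom P Q uV' uE' \<and>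
           (\<forall>v \<in> verts (shape A). uV' (iV v) = hV v) \<and> (\<forall>e \<in> arcs (shape A). uE' (iE e) = hE e) \<and>
           (\<forall>v \<in> verts (shape B). uV' (jV v) = kV v) \<and> (\<forall>e \<in> arcs (shape B). uE' (jE e) = kE e)
           \<longrightarrow> (\<forall>v \<in> verts (shape P). uV' v = uV v) \<and> (\<forall>e \<in> arcs (shape P). uE' e = uE e)))"
    by (intro allI impI, elim conjE, rule univ; assumption)
qed


section \<open>The \<open>!\<close>-box operations\<close>

definition COPY ::
    "'v \<Rightarrow> ('v, 'e, 'o, 'm) typed_graph \<Rightarrow> (('v + 'v) set, ('e + 'e) set, 'o, 'm) typed_graph" where
  "COPY b G = pushout_graph (remove_verts G (verts (shape (B_graph G b)))) G G id id id id"

definition DROP :: "'v \<Rightarrow> ('v, 'e, 'o, 'm) typed_graph \<Rightarrow> ('v, 'e, 'o, 'm) typed_graph" where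
  "DROP b G = remove_verts G {b}"

definition KILL :: "'v \<Rightarrow> ('v, 'e, 'o, 'm) typed_graph \<Rightarrow> ('v, 'e, 'o, 'm) typed_graph" where
  "KILL b G = remove_verts G (verts (shape (B_graph G b)))"

end

theory Submission
  imports Defs
begin

text \<open>
  All conditions on a \<open>!\<close>-graph can be read off single arcs and pairs of arcs with a common end.
  They are inherited by full subgraphs, except that a node-vertex must keep its fixed-arity
  edges. A fixed-arity edge never meets a \<open>!\<close>-vertex, and by openness it never connects
  \<open>B(b)\<close> with its complement; this settles DROP and KILL.

  In COPY every arc lies in one of the two copies of \<open>G\<close>, and two arcs with a common end can be
  taken from the same copy unless that end lies outside \<open>B(b)\<close>. In the latter case openness,
  for wires and fixed-arity edges, and nesting of boxes, for arcs out of \<open>!\<close>-vertices, put the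
  relevant arc outside \<open>B(b)\<close>, where the two copies agree. So each condition for COPY reduces to
  the same condition inside one copy.
\<close>

section \<open>Full subgraphs, adjacency, and edge types that meet \<open>Bang\<close>\<close>

lemma full_subgraph_simps [simp]:
  "verts (shape (full_subgraph G S)) = verts (shape G) \<inter> S"
  "tail (shape (full_subgraph G S)) = tail (shape G)"
  "head (shape (full_subgraph G S)) = head (shape G)"
  "vtype (full_subgraph G S) = vtype G"
  "etype (full_subgraph G S) = etype G"
  by (auto simp: full_subgraph_def)

lemma arcs_full_subgraph [simp]:
  assumes "wf_digraph (shape G)"
  shows "arcs (shape (full_subgraph G S)) =
    {e \<in> arcs (shape G). tail (shape G) e \<in> S \<and> head (shape G) e \<in> S}"
  using assms by (auto simp: full_subgraph_def induce_subgraph_def wf_digraph_def)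

lemma wf_full_subgraph [simp]:
  "wf_digraph (shape G) \<Longrightarrow> wf_digraph (shape (full_subgraph G S))"
  by (auto simp: wf_digraph_def full_subgraph_def induce_subgraph_def)

lemma fin_full_subgraph:
  "fin_digraph (shape G) \<Longrightarrow> fin_digraph (shape (full_subgraph G S))"
  by (simp add: fin_digraph_def fin_digraph_axioms_def)

lemma dominates_iff:
  "u \<rightarrow>\<^bsub>D\<^esub> v \<longleftrightarrow> (\<exists>e \<in> arcs D. tail D e = u \<and> head D e = v)"
  by (auto simp: arcs_ends_def arc_to_ends_def)

text \<open>Both graphs inherit arcs and types from the same \<open>G\<close>, so containment is
  decided on vertices. Nesting of boxes thereby becomes a transitivity condition on arrows.\<close>

lemma typed_subgraph_full_subgraph:
  assumes "wf_digraph (shape G)"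
  shows "typed_subgraph (full_subgraph G S) (full_subgraph G S') \<longleftrightarrow>
    verts (shape G) \<inter> S \<subseteq> S'"
  using assms wf_digraph.tail_in_verts[OF assms] wf_digraph.head_in_verts[OF assms]
  by (auto simp: typed_subgraph_def subgraph_def compatible_def)

lemma fixed_tedge_ends:
  assumes "fixed_tedge t"
  shows "te_tail T t \<noteq> Bang" "te_head T t \<noteq> Bang"
  using assms by (cases t rule: fixed_tedge.cases; simp)+

text \<open>The loop \<open>BangTo Bang\<close> is the only edge into \<open>Bang\<close>. So an arc
  whose tail is not a !-vertex does not end at one either, and later conditions can test the tail
  alone.\<close>

lemma te_head_Bang:
  assumes "te_head T t = Bang"
  shows "te_tail T t = Bang"
  using assms by (cases t) auto

section \<open>The conditions on a !-graph, stated arc by arc\<close>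

text \<open>
  The same class of graphs as \<open>bang_graph\<close>, with every condition stated on the arcs of \<open>G\<close> itself.
  That \<open>U(B(b))\<close> is a string graph follows from the remaining openness conditions, and
  transitivity of \<open>\<beta>(G)\<close> is a special case of \<open>box_trans\<close>.
\<close>

locale elementary_bang_graph =
  fixes T :: "('o, 'm) signature"
    and G :: "('v, 'e, 'o, 'm) typed_graph"
  assumes fin: "fin_digraph (shape G)"
    and typed: "typed_over (bang_typegraph T) G"
    and node_bij: "n \<in> verts (shape G) \<Longrightarrow> vtype G n = Mor f \<Longrightarrow>
      bij_betw (etype G) (fixed_incident G n)
        {t \<in> incident_arcs (typegraph T) (Mor f). fixed_tedge t}"
    and wire_in: "\<lbrakk>e \<in> arcs (shape G); d \<in> arcs (shape G); head (shape G) e = head (shape G) d;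
      vtype G (head (shape G) d) = Obj X;
      vtype G (tail (shape G) e) \<noteq> Bang; vtype G (tail (shape G) d) \<noteq> Bang\<rbrakk> \<Longrightarrow> e = d"
    and wire_out: "\<lbrakk>e \<in> arcs (shape G); d \<in> arcs (shape G); tail (shape G) e = tail (shape G) d;
      vtype G (tail (shape G) d) = Obj X\<rbrakk> \<Longrightarrow> e = d"
    and bang_refl: "b \<in> verts (shape G) \<Longrightarrow> vtype G b = Bang \<Longrightarrow> b \<rightarrow>\<^bsub>shape G\<^esub> b"
    and bang_antisym: "\<lbrakk>b \<rightarrow>\<^bsub>shape G\<^esub> c; c \<rightarrow>\<^bsub>shape G\<^esub> b; vtype G b = Bang; vtype G c = Bang\<rbrakk>
      \<Longrightarrow> b = c"
    and bang_nomulti: "\<lbrakk>e \<in> arcs (shape G); d \<in> arcs (shape G); tail (shape G) e = tail (shape G) d;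
      head (shape G) e = head (shape G) d; vtype G (tail (shape G) d) = Bang;
      vtype G (head (shape G) d) = Bang\<rbrakk> \<Longrightarrow> e = d"
    and box_trans: "\<lbrakk>b \<rightarrow>\<^bsub>shape G\<^esub> c; c \<rightarrow>\<^bsub>shape G\<^esub> v; vtype G b = Bang; vtype G c = Bang\<rbrakk>
      \<Longrightarrow> b \<rightarrow>\<^bsub>shape G\<^esub> v"
    and box_head: "\<lbrakk>b \<rightarrow>\<^bsub>shape G\<^esub> v; v \<rightarrow>\<^bsub>shape G\<^esub> w; vtype G b = Bang; vtype G w = Obj X\<rbrakk>
      \<Longrightarrow> b \<rightarrow>\<^bsub>shape G\<^esub> w"
    and box_tail: "\<lbrakk>b \<rightarrow>\<^bsub>shape G\<^esub> v; w \<rightarrow>\<^bsub>shape G\<^esub> v; vtype G b = Bang; vtype G w = Obj X\<rbrakk>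
      \<Longrightarrow> b \<rightarrow>\<^bsub>shape G\<^esub> w"
    and box_fixed: "\<lbrakk>e \<in> arcs (shape G); fixed_tedge (etype G e); vtype G b = Bang\<rbrakk>
      \<Longrightarrow> b \<rightarrow>\<^bsub>shape G\<^esub> tail (shape G) e \<longleftrightarrow> b \<rightarrow>\<^bsub>shape G\<^esub> head (shape G) e"

section \<open>Equivalence of the two descriptions of !-graphs\<close>

lemma typed_over_bang_arc:
  assumes "typed_over (bang_typegraph T) G" "e \<in> arcs (shape G)"
  shows "tail (shape G) e \<in> verts (shape G)" "head (shape G) e \<in> verts (shape G)"
    "te_tail T (etype G e) = vtype G (tail (shape G) e)"
    "te_head T (etype G e) = vtype G (head (shape G) e)"
  using assms by (auto simp: typed_over_def bang_typegraph_def wf_digraph_def)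

lemma typed_over_bang_head:
  assumes "typed_over (bang_typegraph T) G" "e \<in> arcs (shape G)"
    "vtype G (head (shape G) e) = Bang"
  shows "vtype G (tail (shape G) e) = Bang"
  using typed_over_bang_arc[OF assms(1,2)] assms(3) te_head_Bang by metis

lemma typed_over_bang_fixed:
  assumes "typed_over (bang_typegraph T) G" "e \<in> arcs (shape G)" "fixed_tedge (etype G e)"
  shows "vtype G (tail (shape G) e) \<noteq> Bang" "vtype G (head (shape G) e) \<noteq> Bang"
  using typed_over_bang_arc[OF assms(1,2)] fixed_tedge_ends[OF assms(3)] by metis+

lemma
  assumes "typed_over (bang_typegraph T) G"
  shows verts_U_graph: "verts (shape (U_graph G)) = {v \<in> verts (shape G). vtype G v \<noteq> Bang}"
    and arcs_U_graph: "arcs (shape (U_graph G)) =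
      {e \<in> arcs (shape G). vtype G (tail (shape G) e) \<noteq> Bang}"
    and ends_U_graph: "tail (shape (U_graph G)) = tail (shape G)"
      "head (shape (U_graph G)) = head (shape G)"
      "vtype (U_graph G) = vtype G" "etype (U_graph G) = etype G"
proof -
  have wf: "wf_digraph (shape G)" using assms by (simp add: typed_over_def)
  show "verts (shape (U_graph G)) = {v \<in> verts (shape G). vtype G v \<noteq> Bang}"
    by (auto simp: U_graph_def remove_verts_def bang_verts_def)
  show "arcs (shape (U_graph G)) = {e \<in> arcs (shape G). vtype G (tail (shape G) e) \<noteq> Bang}"
    using typed_over_bang_head[OF assms] typed_over_bang_arc[OF assms]
    by (auto simp: U_graph_def remove_verts_def bang_verts_def wf)
qed (simp_all add: U_graph_def remove_verts_def)

lemmas U_graph_simps = verts_U_graph arcs_U_graph ends_U_graph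

text \<open>Every edge that \<open>bang_typegraph\<close> adds is a \<open>BangTo\<close>, with tail
  \<open>Bang\<close>; the arcs typed by these are the ones that \<open>U_graph\<close>
  removes.\<close>

lemma typed_over_U_graph:
  assumes "typed_over (bang_typegraph T) G"
  shows "typed_over (typegraph T) (U_graph G)"
proof -
  have "etype G e \<in> arcs (typegraph T)"
    if "e \<in> arcs (shape G)" "vtype G (tail (shape G) e) \<noteq> Bang" for e
  proof -
    have "etype G e \<in> arcs (bang_typegraph T)" using assms that by (auto simp: typed_over_def)
    then show ?thesis using that typed_over_bang_arc(3)[OF assms that(1)]
      by (auto simp: bang_typegraph_def)
  qed
  then show ?thesis
    using assms typed_over_bang_arc[OF assms] typed_over_bang_head[OF assms]
    by (auto simp: typed_over_def U_graph_simps[OF assms] wf_digraph_def bang_typegraph_def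
        typegraph_def)
qed

lemma fixed_incident_U_graph:
  assumes "typed_over (bang_typegraph T) G"
  shows "fixed_incident (U_graph G) v = fixed_incident G v"
  using typed_over_bang_fixed[OF assms]
  by (auto simp: fixed_incident_def incident_arcs_def in_arcs_def out_arcs_def
      U_graph_simps[OF assms])

text \<open>A degree bound of one says that two arcs with a common end are equal. On the incoming
  side arcs from !-vertices are excluded, as \<open>U_graph\<close> removes them; an arc leaving a
  wire-vertex always survives.\<close>

lemma string_graph_U_graph_iff:
  assumes "typed_over (bang_typegraph T) G" "fin_digraph (shape G)"
  shows "string_graph T (U_graph G) \<longleftrightarrow>
    (\<forall>n \<in> verts (shape G). \<forall>f. vtype G n = Mor f \<longrightarrow> bij_betw (etype G) (fixed_incident G n)
        {t \<in> incident_arcs (typegraph T) (Mor f). fixed_tedge t}) \<and>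
    (\<forall>e \<in> arcs (shape G). \<forall>d \<in> arcs (shape G). \<forall>X. head (shape G) e = head (shape G) d \<longrightarrow>
      vtype G (head (shape G) d) = Obj X \<longrightarrow> vtype G (tail (shape G) e) \<noteq> Bang \<longrightarrow>
      vtype G (tail (shape G) d) \<noteq> Bang \<longrightarrow> e = d) \<and>
    (\<forall>e \<in> arcs (shape G). \<forall>d \<in> arcs (shape G). \<forall>X. tail (shape G) e = tail (shape G) d \<longrightarrow>
      vtype G (tail (shape G) d) = Obj X \<longrightarrow> e = d)"
    (is "_ \<longleftrightarrow> ?nodes \<and> ?ins \<and> ?outs")
proof -
  note U = U_graph_simps[OF assms(1)] and ends = typed_over_bang_arc[OF assms(1)]
  have finU: "fin_digraph (shape (U_graph G))"
    using assms(2) by (simp add: U_graph_def remove_verts_def fin_full_subgraph)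
  \<comment> \<open>Finiteness gives the degree bound its meaning, since the cardinality of an
    infinite set is 0.\<close>
  have fin_arcs: "finite {e \<in> arcs (shape G). P e}" for P
    using assms(2) by (simp add: fin_digraph_def fin_digraph_axioms_def)
  have "(\<forall>n \<in> node_verts (U_graph G). bij_betw (etype (U_graph G)) (fixed_incident (U_graph G) n)
        {t \<in> incident_arcs (typegraph T) (vtype (U_graph G) n). fixed_tedge t}) \<longleftrightarrow> ?nodes"
    by (auto simp: node_verts_def U fixed_incident_U_graph[OF assms(1)])
  moreover have "(\<forall>w \<in> wire_verts (U_graph G). in_degree (shape (U_graph G)) w \<le> 1) \<longleftrightarrow> ?ins"
    (is "?L \<longleftrightarrow> _")
  proof -
    have "?L \<longleftrightarrow> (\<forall>w X. w \<in> verts (shape G) \<and> vtype G w = Obj X \<longrightarrow>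
        (\<forall>e d. (e \<in> arcs (shape G) \<and> vtype G (tail (shape G) e) \<noteq> Bang \<and> head (shape G) e = w) \<and>
          (d \<in> arcs (shape G) \<and> vtype G (tail (shape G) d) \<noteq> Bang \<and> head (shape G) d = w) \<longrightarrow>
          e = d))"
      by (auto simp: wire_verts_def U in_degree_def in_arcs_def card_le_Suc0_iff_eq fin_arcs)
    also have "\<dots> \<longleftrightarrow> ?ins" using ends(2) by blast
    finally show ?thesis .
  qed
  moreover have "(\<forall>w \<in> wire_verts (U_graph G). out_degree (shape (U_graph G)) w \<le> 1) \<longleftrightarrow> ?outs"
    (is "?L \<longleftrightarrow> _")
  proof -
    have "?L \<longleftrightarrow> (\<forall>w X. w \<in> verts (shape G) \<and> vtype G w = Obj X \<longrightarrow>
        (\<forall>e d. (e \<in> arcs (shape G) \<and> tail (shape G) e = w) \<and>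
          (d \<in> arcs (shape G) \<and> tail (shape G) d = w) \<longrightarrow> e = d))"
      by (auto simp: wire_verts_def U out_degree_def out_arcs_def card_le_Suc0_iff_eq fin_arcs)
    also have "\<dots> \<longleftrightarrow> ?outs" using ends(1) by blast
    finally show ?thesis .
  qed
  ultimately show ?thesis
    using finU typed_over_U_graph[OF assms(1)] by (auto simp: string_graph_def)
qed

lemma posetal_beta_graph_iff:
  assumes "typed_over (bang_typegraph T) G"
  shows "posetal (shape (beta_graph G)) \<longleftrightarrow>
    (\<forall>e \<in> arcs (shape G). \<forall>d \<in> arcs (shape G). tail (shape G) e = tail (shape G) d \<longrightarrow>
      head (shape G) e = head (shape G) d \<longrightarrow> vtype G (tail (shape G) d) = Bang \<longrightarrow>
      vtype G (head (shape G) d) = Bang \<longrightarrow> e = d) \<and>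
    (\<forall>b \<in> bang_verts G. b \<rightarrow>\<^bsub>shape G\<^esub> b) \<and>
    (\<forall>b \<in> bang_verts G. \<forall>c \<in> bang_verts G. \<forall>d \<in> bang_verts G.
      b \<rightarrow>\<^bsub>shape G\<^esub> c \<longrightarrow> c \<rightarrow>\<^bsub>shape G\<^esub> d \<longrightarrow> b \<rightarrow>\<^bsub>shape G\<^esub> d) \<and>
    (\<forall>b \<in> bang_verts G. \<forall>c \<in> bang_verts G. b \<rightarrow>\<^bsub>shape G\<^esub> c \<longrightarrow> c \<rightarrow>\<^bsub>shape G\<^esub> b \<longrightarrow> b = c)"
    (is "_ \<longleftrightarrow> ?nomulti \<and> ?refl \<and> ?trans \<and> ?antisym")
proof -
  have wf: "wf_digraph (shape G)" using assms by (simp add: typed_over_def)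
  note ends = typed_over_bang_arc[OF assms]
  have arrow: "(u, v) \<in> arcs_ends (shape (beta_graph G)) \<longleftrightarrow>
      u \<in> bang_verts G \<and> v \<in> bang_verts G \<and> u \<rightarrow>\<^bsub>shape G\<^esub> v" for u v
    by (auto simp: dominates_iff beta_graph_def wf)
  have V: "verts (shape (beta_graph G)) = bang_verts G"
    by (auto simp: beta_graph_def bang_verts_def)
  have "nomulti_digraph (shape (beta_graph G)) \<longleftrightarrow> ?nomulti"
    using ends
    by (auto simp: nomulti_digraph_def nomulti_digraph_axioms_def beta_graph_def wf
        arc_to_ends_def bang_verts_def)
  moreover have "partial_order_on (verts (shape (beta_graph G))) (arcs_ends (shape (beta_graph G)))
      \<longleftrightarrow> ?refl \<and> ?trans \<and> ?antisym"
  proof -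
    let ?r = "arcs_ends (shape (beta_graph G))"
    have "?r \<subseteq> bang_verts G \<times> bang_verts G" by (rule subrelI) (simp add: arrow)
    moreover have "refl_on (bang_verts G) ?r \<longleftrightarrow> ?refl"
      unfolding refl_on_def by (simp add: arrow)
    moreover have "antisym ?r \<longleftrightarrow> ?antisym" unfolding antisym_def arrow by blast
    moreover have "trans ?r \<longleftrightarrow> ?trans" unfolding trans_def arrow by blast
    ultimately show ?thesis
      unfolding partial_order_on_def preorder_on_def V by simp
  qed
  ultimately show ?thesis by (simp add: posetal_def)
qed

text \<open>\<open>U_graph (B_graph G b)\<close> is always a typed subgraph of
  \<open>U_graph G\<close>, so openness amounts to two clauses about wire-vertices and one about
  fixed-arity arcs. The last one also makes it a string graph.\<close>

lemma open_box_iff: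
  assumes "typed_over (bang_typegraph T) G" "fin_digraph (shape G)" "string_graph T (U_graph G)"
    and b: "b \<in> bang_verts G"
  shows "open_subgraph T (U_graph (B_graph G b)) (U_graph G) \<longleftrightarrow>
    (\<forall>d \<in> arcs (shape G). \<forall>X. vtype G (tail (shape G) d) \<noteq> Bang \<longrightarrow>
        vtype G (head (shape G) d) = Obj X \<longrightarrow>
        b \<rightarrow>\<^bsub>shape G\<^esub> tail (shape G) d \<longrightarrow> b \<rightarrow>\<^bsub>shape G\<^esub> head (shape G) d) \<and>
    (\<forall>d \<in> arcs (shape G). \<forall>X. vtype G (tail (shape G) d) = Obj X \<longrightarrow>
        b \<rightarrow>\<^bsub>shape G\<^esub> head (shape G) d \<longrightarrow> b \<rightarrow>\<^bsub>shape G\<^esub> tail (shape G) d) \<and>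
    (\<forall>e \<in> arcs (shape G). fixed_tedge (etype G e) \<longrightarrow>
        b \<rightarrow>\<^bsub>shape G\<^esub> tail (shape G) e \<longleftrightarrow> b \<rightarrow>\<^bsub>shape G\<^esub> head (shape G) e)"
    (is "_ \<longleftrightarrow> ?heads \<and> ?tails \<and> ?fixed")
proof -
  let ?H = "U_graph (B_graph G b)"
  let ?in = "\<lambda>v. b \<rightarrow>\<^bsub>shape G\<^esub> v"
  have wf: "wf_digraph (shape G)" using assms by (simp add: typed_over_def)
  have BT: "typed_over (bang_typegraph T) (B_graph G b)"
    unfolding B_graph_def using assms(1) by (rule full_subgraph_typed)
  note ends = typed_over_bang_arc[OF assms(1)]
  note U = U_graph_simps[OF assms(1)] and UB = U_graph_simps[OF BT]
  have Bs: "verts (shape (B_graph G b)) = {v \<in> verts (shape G). ?in v}"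
    "arcs (shape (B_graph G b)) =
       {e \<in> arcs (shape G). ?in (tail (shape G) e) \<and> ?in (head (shape G) e)}"
    "tail (shape (B_graph G b)) = tail (shape G)" "head (shape (B_graph G b)) = head (shape G)"
    "vtype (B_graph G b) = vtype G" "etype (B_graph G b) = etype G"
    by (auto simp: B_graph_def wf)
  have finB: "fin_digraph (shape (B_graph G b))"
    by (simp add: B_graph_def fin_full_subgraph assms(2))
  have wfU: "wf_digraph (shape (U_graph G))" "wf_digraph (shape ?H)"
    using typed_over_U_graph[OF assms(1)] typed_over_U_graph[OF BT] by (auto simp: typed_over_def)
  have sub: "typed_subgraph ?H (U_graph G)"
    using wfU by (auto simp: typed_subgraph_def subgraph_def compatible_def U UB Bs)
  have wires: "(\<forall>v \<in> verts (shape ?H). \<forall>w \<in> wire_verts (U_graph G) - verts (shape ?H).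
        \<not> v \<rightarrow>\<^bsub>shape (U_graph G)\<^esub> w \<and> \<not> w \<rightarrow>\<^bsub>shape (U_graph G)\<^esub> v) \<longleftrightarrow> ?heads \<and> ?tails"
    (is "?open \<longleftrightarrow> _")
  proof
    assume o: ?open
    have arrow: "tail (shape G) d \<rightarrow>\<^bsub>shape (U_graph G)\<^esub> head (shape G) d"
      if "d \<in> arcs (shape G)" "vtype G (tail (shape G) d) \<noteq> Bang" for d
      using that unfolding dominates_iff by (auto simp: U)
    have ?heads
    proof (intro ballI allI impI, rule ccontr)
      fix d X
      assume d: "d \<in> arcs (shape G)" "vtype G (tail (shape G) d) \<noteq> Bang"
        "vtype G (head (shape G) d) = Obj X" "?in (tail (shape G) d)" "\<not> ?in (head (shape G) d)"
      then have "tail (shape G) d \<in> verts (shape ?H)"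
        "head (shape G) d \<in> wire_verts (U_graph G) - verts (shape ?H)"
        using ends by (auto simp: UB Bs U wire_verts_def)
      then show False using o arrow[OF d(1,2)] by blast
    qed
    moreover have ?tails
    proof (intro ballI allI impI, rule ccontr)
      fix d X
      assume d: "d \<in> arcs (shape G)" "vtype G (tail (shape G) d) = Obj X"
        "?in (head (shape G) d)" "\<not> ?in (tail (shape G) d)"
      then have "head (shape G) d \<in> verts (shape ?H)"
        "tail (shape G) d \<in> wire_verts (U_graph G) - verts (shape ?H)"
        using ends typed_over_bang_head[OF assms(1) d(1)] by (auto simp: UB Bs U wire_verts_def)
      then show False using o arrow[OF d(1)] d(2) by auto
    qed
    ultimately show "?heads \<and> ?tails" ..
  next
    assume "?heads \<and> ?tails"
    then have h: ?heads and t: ?tails by blast+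
    show ?open
    proof (intro ballI conjI notI)
      fix v w
      assume v: "v \<in> verts (shape ?H)" and w: "w \<in> wire_verts (U_graph G) - verts (shape ?H)"
      {
        assume "v \<rightarrow>\<^bsub>shape (U_graph G)\<^esub> w"
        then show False using v w h unfolding dominates_iff[of _ "shape (U_graph G)"]
          by (auto simp: U UB Bs wire_verts_def)
      next
        assume "w \<rightarrow>\<^bsub>shape (U_graph G)\<^esub> v"
        then show False using v w t unfolding dominates_iff[of _ "shape (U_graph G)"]
          by (auto simp: U UB Bs wire_verts_def)
      }
    qed
  qed
  have fixed: "(\<forall>v \<in> verts (shape ?H). fixed_incident (U_graph G) v \<subseteq> arcs (shape ?H)) \<longleftrightarrow> ?fixed"
    (is "?L \<longleftrightarrow> _")
  proof
    assume L: ?L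
    show ?fixed
    proof (intro ballI impI)
      fix e assume e: "e \<in> arcs (shape G)" "fixed_tedge (etype G e)"
      have "e \<in> fixed_incident (U_graph G) (tail (shape G) e)"
        "e \<in> fixed_incident (U_graph G) (head (shape G) e)"
        using e unfolding fixed_incident_U_graph[OF assms(1)]
        by (auto simp: fixed_incident_def incident_arcs_def)
      \<comment> \<open>No end of a fixed-arity arc is a !-vertex, so an end inside the box survives
        in \<open>?H\<close>.\<close>
      moreover have "tail (shape G) e \<in> verts (shape ?H)" if "?in (tail (shape G) e)"
        using that e ends typed_over_bang_fixed[OF assms(1)] by (auto simp: UB Bs)
      moreover have "head (shape G) e \<in> verts (shape ?H)" if "?in (head (shape G) e)"
        using that e ends typed_over_bang_fixed[OF assms(1)] by (auto simp: UB Bs)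
      ultimately show "?in (tail (shape G) e) \<longleftrightarrow> ?in (head (shape G) e)"
        using L by (auto simp: UB Bs)
    qed
  next
    assume ?fixed
    then show ?L
      using typed_over_bang_fixed[OF assms(1)] unfolding fixed_incident_U_graph[OF assms(1)]
      by (auto simp: fixed_incident_def incident_arcs_def UB Bs)
  qed
  \<comment> \<open>\<open>?fixed\<close> keeps every fixed-arity arc at a vertex of the box, so the
    node bijections carry over; the wire conditions pass to any subset of the arcs.\<close>
  have "string_graph T ?H" if f: ?fixed
  proof -
    have "fixed_incident (B_graph G b) v = fixed_incident G v" if "?in v" for v
      using that f by (auto simp: fixed_incident_def incident_arcs_def in_arcs_def out_arcs_def Bs)
    then show ?thesis
      using assms(3) unfolding string_graph_U_graph_iff[OF BT finB]
        string_graph_U_graph_iff[OF assms(1,2)] Bs by (simp; blast)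
  qed
  then show ?thesis
    unfolding open_subgraph_def wires fixed using sub by blast
qed

lemma bang_graph_iff_elementary: "bang_graph T G \<longleftrightarrow> elementary_bang_graph T G"
\<comment> \<open>Both sides demand finiteness and typing, so they fail together in the other
  case.\<close>
proof (cases "fin_digraph (shape G) \<and> typed_over (bang_typegraph T) G")
  case True
  then have fin: "fin_digraph (shape G)" and typed: "typed_over (bang_typegraph T) G"
    and wf: "wf_digraph (shape G)"
    by (auto simp: typed_over_def)
  note ends = typed_over_bang_arc[OF typed]
  have verts: "u \<in> verts (shape G)" "v \<in> verts (shape G)" if "u \<rightarrow>\<^bsub>shape G\<^esub> v" for u v
    using that ends by (auto simp: dominates_iff)
  have nested: "(\<forall>b \<in> bang_verts G. \<forall>b' \<in> bang_verts (B_graph G b).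
        typed_subgraph (B_graph G b') (B_graph G b)) \<longleftrightarrow>
      (\<forall>b c v. b \<rightarrow>\<^bsub>shape G\<^esub> c \<longrightarrow> c \<rightarrow>\<^bsub>shape G\<^esub> v \<longrightarrow> vtype G b = Bang \<longrightarrow> vtype G c = Bang \<longrightarrow>
        b \<rightarrow>\<^bsub>shape G\<^esub> v)"
    unfolding B_graph_def typed_subgraph_full_subgraph[OF wf]
    unfolding bang_verts_def full_subgraph_simps using verts by blast
  show ?thesis
  proof
    assume G: "bang_graph T G"
    then have str: "string_graph T (U_graph G)" and pos: "posetal (shape (beta_graph G))"
      by (auto simp: bang_graph_def)
    have tr: "\<And>b c v. b \<rightarrow>\<^bsub>shape G\<^esub> c \<Longrightarrow> c \<rightarrow>\<^bsub>shape G\<^esub> v \<Longrightarrow> vtype G b = Bang \<Longrightarrow> vtype G c = Bang \<Longrightarrow>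
        b \<rightarrow>\<^bsub>shape G\<^esub> v"
      using G nested unfolding bang_graph_def by blast
    have op: "open_subgraph T (U_graph (B_graph G b)) (U_graph G)" if "b \<in> bang_verts G" for b
      using G that by (auto simp: bang_graph_def)
    \<comment> \<open>The new \<open>op\<close> has the premise \<open>b \<in> bang_verts G\<close>
      twice, once from \<open>open_box_iff\<close> and once from the old \<open>op\<close>; hence
      \<open>bang\<close> is supplied twice below.\<close>
    note op = iffD1[OF open_box_iff[OF typed fin str] op]
    note str = str[unfolded string_graph_U_graph_iff[OF typed fin]]
    note pos = pos[unfolded posetal_beta_graph_iff[OF typed]]
    have bang: "b \<in> bang_verts G" if "b \<rightarrow>\<^bsub>shape G\<^esub> v" "vtype G b = Bang" for b v
      using that verts by (auto simp: bang_verts_def)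
    show "elementary_bang_graph T G"
    proof (rule elementary_bang_graph.intro)
      show "b \<rightarrow>\<^bsub>shape G\<^esub> w" if "b \<rightarrow>\<^bsub>shape G\<^esub> v" "v \<rightarrow>\<^bsub>shape G\<^esub> w" "vtype G b = Bang" "vtype G w = Obj X"
        for b v w X
      \<comment> \<open>Openness lives in \<open>U_graph G\<close> and is silent on arcs that leave
        a !-vertex. When \<open>v\<close> is one, nesting of boxes gives the arrow instead.\<close>
      proof (cases "vtype G v = Bang")
        case False
        then show ?thesis
          using that op[OF bang[OF that(1,3)] bang[OF that(1,3)]] unfolding dominates_iff[of v] by blast
      qed (use tr that in blast)
      show "b \<rightarrow>\<^bsub>shape G\<^esub> w" if "b \<rightarrow>\<^bsub>shape G\<^esub> v" "w \<rightarrow>\<^bsub>shape G\<^esub> v" "vtype G b = Bang" "vtype G w = Obj X"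
        for b v w X
        using that op[OF bang[OF that(1,3)] bang[OF that(1,3)]] unfolding dominates_iff[of w] by blast
      show "b \<rightarrow>\<^bsub>shape G\<^esub> tail (shape G) e \<longleftrightarrow> b \<rightarrow>\<^bsub>shape G\<^esub> head (shape G) e"
        if "e \<in> arcs (shape G)" "fixed_tedge (etype G e)" "vtype G b = Bang" for e b
        using that op[of b] bang by blast
      show "b = c" if "b \<rightarrow>\<^bsub>shape G\<^esub> c" "c \<rightarrow>\<^bsub>shape G\<^esub> b" "vtype G b = Bang" "vtype G c = Bang" for b c
        using that pos bang by blast
    qed (use fin typed str pos tr in \<open>auto simp: bang_verts_def\<close>)
  next
    assume "elementary_bang_graph T G"
    then interpret elementary_bang_graph T G .
    have str: "string_graph T (U_graph G)"
      unfolding string_graph_U_graph_iff[OF typed fin]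
      using node_bij wire_in wire_out by blast
    have "posetal (shape (beta_graph G))"
      unfolding posetal_beta_graph_iff[OF typed] bang_verts_def
      using bang_nomulti bang_refl bang_antisym box_trans by blast
    moreover have "open_subgraph T (U_graph (B_graph G b)) (U_graph G)" if "b \<in> bang_verts G" for b
    proof -
      have "vtype G b = Bang" using that by (simp add: bang_verts_def)
      moreover have "tail (shape G) d \<rightarrow>\<^bsub>shape G\<^esub> head (shape G) d" if "d \<in> arcs (shape G)" for d
        using that by (auto simp: dominates_iff)
      ultimately show ?thesis
        unfolding open_box_iff[OF typed fin str that]
        using box_head box_tail box_fixed by blast
    qed
    ultimately show "bang_graph T G"
      unfolding bang_graph_def nested using fin typed str box_trans by blast
  qed
qed (auto simp: bang_graph_def dest: elementary_bang_graph.fin elementary_bang_graph.typed)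

section \<open>Closure under full subgraphs\<close>

context elementary_bang_graph
begin

lemma wf: "wf_digraph (shape G)"
  using typed by (simp add: typed_over_def)

lemmas ends = typed_over_bang_arc[OF typed]

lemma arrow: "e \<in> arcs (shape G) \<Longrightarrow> tail (shape G) e \<rightarrow>\<^bsub>shape G\<^esub> head (shape G) e"
  by (auto simp: dominates_iff)

text \<open>Apart from finiteness, typing and \<open>node_bij\<close>, each condition concludes only
  equalities or arrows among what its premises name, so it is inherited. A node-vertex in
  \<open>S\<close> keeps its fixed-arity arcs because \<open>S\<close> never separates the ends of
  such an arc.\<close>

lemma elementary_full_subgraph:
  assumes S: "\<And>e. \<lbrakk>e \<in> arcs (shape G); fixed_tedge (etype G e)\<rbrakk>
      \<Longrightarrow> tail (shape G) e \<in> S \<longleftrightarrow> head (shape G) e \<in> S"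
  shows "elementary_bang_graph T (full_subgraph G S)"
proof -
  let ?H = "full_subgraph G S"
  have H: "u \<rightarrow>\<^bsub>shape ?H\<^esub> v \<longleftrightarrow> u \<rightarrow>\<^bsub>shape G\<^esub> v \<and> u \<in> S \<and> v \<in> S" for u v
    unfolding dominates_iff by (auto simp: wf)
  have inc: "fixed_incident ?H n = fixed_incident G n" if "n \<in> S" for n
    using that S by (auto simp: fixed_incident_def incident_arcs_def in_arcs_def out_arcs_def wf)
  show ?thesis
  proof (rule elementary_bang_graph.intro, unfold H full_subgraph_simps arcs_full_subgraph[OF wf])
    show "typed_over (bang_typegraph T) ?H" by (rule full_subgraph_typed[OF typed])
  next
    fix n f assume "n \<in> verts (shape G) \<inter> S" "vtype G n = Mor f"
    then show "bij_betw (etype G) (fixed_incident ?H n)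
        {t \<in> incident_arcs (typegraph T) (Mor f). fixed_tedge t}"
      using node_bij inc by simp
  next
    fix e b assume "e \<in> {e \<in> arcs (shape G). tail (shape G) e \<in> S \<and> head (shape G) e \<in> S}"
      "fixed_tedge (etype G e)" "vtype G b = Bang"
    then show "(b \<rightarrow>\<^bsub>shape G\<^esub> tail (shape G) e \<and> b \<in> S \<and> tail (shape G) e \<in> S) \<longleftrightarrow>
        (b \<rightarrow>\<^bsub>shape G\<^esub> head (shape G) e \<and> b \<in> S \<and> head (shape G) e \<in> S)"
      using box_fixed[of e b] by blast
  \<comment> \<open>Membership in \<open>S\<close> is split off and closed by assumption; the rest
    of each goal is the corresponding condition for \<open>G\<close>. The number after
    \<open>erule\<close> counts the further premises closed by assumption.\<close>
  qed (rule fin_full_subgraph[OF fin] | ((elim CollectE conjE IntE)?, (intro conjI)?,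
      (assumption | erule (1) bang_refl | erule (5) wire_in | erule (3) wire_out |
        erule (3) bang_antisym | erule (5) bang_nomulti |
        erule (3) box_trans | erule (3) box_head | erule (3) box_tail)+; fail))+
qed

section \<open>Two copies of a !-graph glued along the complement of a box\<close>

text \<open>
  \<open>cV k\<close> and \<open>cE k\<close> stand for the two coprojections into the pushout, indexed by \<open>k\<close>. The fact
  \<open>box\<close> in the proof says that every arc from a \<open>!\<close>-vertex \<open>x\<close> to a vertex of copy \<open>l\<close> comes
  from copy \<open>l\<close>, because the successors of a \<open>!\<close>-vertex in \<open>B(b)\<close> stay in \<open>B(b)\<close>.
\<close>

lemma elementary_doubled:
  fixes P :: "('w, 'd, 'o, 'm) typed_graph"
    and cV :: "bool \<Rightarrow> 'v \<Rightarrow> 'w" and cE :: "bool \<Rightarrow> 'e \<Rightarrow> 'd"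
  assumes b: "vtype G b = Bang"
    and P_typed: "typed_over (bang_typegraph T) P"
    and hom: "\<And>k. typed_hom G P (cV k) (cE k)"
    and P_verts: "verts (shape P) = (\<Union>k. cV k ` verts (shape G))"
    and P_arcs: "arcs (shape P) = (\<Union>k. cE k ` arcs (shape G))"
    and cV_eq: "\<And>k l u v. \<lbrakk>u \<in> verts (shape G); v \<in> verts (shape G)\<rbrakk> \<Longrightarrow>
      cV k u = cV l v \<longleftrightarrow> u = v \<and> (k = l \<or> \<not> b \<rightarrow>\<^bsub>shape G\<^esub> u)"
    and cE_eq: "\<And>k l e d. \<lbrakk>e \<in> arcs (shape G); d \<in> arcs (shape G)\<rbrakk> \<Longrightarrow>
      cE k e = cE l d \<longleftrightarrow> e = d \<and>
        (k = l \<or> \<not> b \<rightarrow>\<^bsub>shape G\<^esub> tail (shape G) e \<and> \<not> b \<rightarrow>\<^bsub>shape G\<^esub> head (shape G) e)"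
  shows "elementary_bang_graph T P"
proof -
  have cV [simp]: "vtype P (cV k v) = vtype G v" if "v \<in> verts (shape G)" for k v
    using hom that by (auto simp: typed_hom_def)
  have cE: "etype P (cE k e) = etype G e" "tail (shape P) (cE k e) = cV k (tail (shape G) e)"
    "head (shape P) (cE k e) = cV k (head (shape G) e)" "cE k e \<in> arcs (shape P)"
    if "e \<in> arcs (shape G)" for k e
    using hom that by (auto simp: typed_hom_def)
  note [simp] = cE(1-3) and [simp] = ends(1,2)
  have arcP: "\<exists>k. \<exists>e \<in> arcs (shape G). x = cE k e" if "x \<in> arcs (shape P)" for x
    using that by (auto simp: P_arcs)
  have vG: "u \<in> verts (shape G)" "v \<in> verts (shape G)" if "u \<rightarrow>\<^bsub>shape G\<^esub> v" for u v
    using that by (auto simp: dominates_iff)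
  have lift: "cV k u \<rightarrow>\<^bsub>shape P\<^esub> cV k v" if "u \<rightarrow>\<^bsub>shape G\<^esub> v" for k u v
    using that cE unfolding dominates_iff by metis
  have arrowP: "\<exists>k u v. x = cV k u \<and> y = cV k v \<and> u \<rightarrow>\<^bsub>shape G\<^esub> v" if "x \<rightarrow>\<^bsub>shape P\<^esub> y" for x y
  proof -
    from that obtain d where d: "d \<in> arcs (shape P)" "tail (shape P) d = x" "head (shape P) d = y"
      by (auto simp: dominates_iff)
    with arcP[OF d(1)] arrow show ?thesis by (metis cE(2,3))
  qed
  have box: "\<exists>u. x = cV l u \<and> u \<rightarrow>\<^bsub>shape G\<^esub> v \<and> vtype G u = Bang"
    if x: "x \<rightarrow>\<^bsub>shape P\<^esub> cV l v" "vtype P x = Bang" "v \<in> verts (shape G)" for x l v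
  proof -
    obtain k u v' where e: "x = cV k u" "cV l v = cV k v'" "u \<rightarrow>\<^bsub>shape G\<^esub> v'"
      using arrowP[OF x(1)] by blast
    have u: "u \<in> verts (shape G)" "v' \<in> verts (shape G)" "vtype G u = Bang"
      using e vG x(2) by auto
    then have v: "v' = v" "k = l \<or> \<not> b \<rightarrow>\<^bsub>shape G\<^esub> v" using e cV_eq x(3) by metis+
    then have "k = l \<or> \<not> b \<rightarrow>\<^bsub>shape G\<^esub> u" using box_trans[OF _ _ b u(3)] e(3) by blast
    then have "cV k u = cV l u" using cV_eq u by metis
    then show ?thesis using e v u by blast
  qed
  have inc: "fixed_incident P (cV k v) = cE k ` fixed_incident G v"
    if v: "v \<in> verts (shape G)" for k v
  proof (intro equalityI subsetI)
    fix x assume x: "x \<in> fixed_incident P (cV k v)"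
    then have xP: "x \<in> arcs (shape P)" by (auto simp: fixed_incident_def incident_arcs_def)
    obtain l e where e: "e \<in> arcs (shape G)" "x = cE l e" using arcP[OF xP] by blast
    have f: "fixed_tedge (etype G e)" and "cV l (tail (shape G) e) = cV k v \<or> cV l (head (shape G) e) = cV k v"
      using x e by (auto simp: fixed_incident_def incident_arcs_def)
    \<comment> \<open>If the copies \<open>l\<close> and \<open>k\<close> differ, the common vertex
      \<open>v\<close> lies outside B(b). Then \<open>box_fixed\<close> puts the other end outside
      as well, and the arc is shared by both copies.\<close>
    then have "tail (shape G) e = v \<or> head (shape G) e = v" "l = k \<or> \<not> b \<rightarrow>\<^bsub>shape G\<^esub> v"
      using cV_eq e v by (metis ends(1,2))+
    then have "cE l e = cE k e" and "e \<in> fixed_incident G v"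
      using cE_eq[OF e(1) e(1)] box_fixed[OF e(1) f b] e f
      by (auto simp: fixed_incident_def incident_arcs_def)
    then show "x \<in> cE k ` fixed_incident G v" using e by auto
  next
    fix x assume "x \<in> cE k ` fixed_incident G v"
    then show "x \<in> fixed_incident P (cV k v)"
      by (auto simp: fixed_incident_def incident_arcs_def cE(4))
  qed
  show ?thesis
  proof (rule elementary_bang_graph.intro)
    have "finite (verts (shape P))" "finite (arcs (shape P))"
      using fin by (auto simp: P_verts P_arcs fin_digraph_def fin_digraph_axioms_def)
    then show "fin_digraph (shape P)"
      using P_typed by (auto simp: typed_over_def fin_digraph_def fin_digraph_axioms_def)
    show "typed_over (bang_typegraph T) P" by (rule P_typed)
  next
    fix n f assume n: "n \<in> verts (shape P)" "vtype P n = Mor f"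
    then obtain k v where v: "v \<in> verts (shape G)" "n = cV k v" by (auto simp: P_verts)
    have "bij_betw (etype G) (fixed_incident G v)
        {t \<in> incident_arcs (typegraph T) (Mor f). fixed_tedge t}"
      using n v node_bij by simp
    \<comment> \<open>On arcs of \<open>G\<close> this composite agrees with \<open>etype G\<close>.
      Its injectivity yields that of \<open>etype P\<close> on the image under \<open>cE k\<close>,
      so the bijection moves to \<open>P\<close> directly.\<close>
    moreover have "bij_betw (etype P \<circ> cE k) (fixed_incident G v) A \<longleftrightarrow>
        bij_betw (etype G) (fixed_incident G v) A" for A
      by (rule bij_betw_cong) (auto simp: fixed_incident_def incident_arcs_def)
    ultimately have "bij_betw (etype P \<circ> cE k) (fixed_incident G v)
        {t \<in> incident_arcs (typegraph T) (Mor f). fixed_tedge t}"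
      by simp
    then show "bij_betw (etype P) (fixed_incident P n)
        {t \<in> incident_arcs (typegraph T) (Mor f). fixed_tedge t}"
      unfolding v(2) inc[OF v(1)] bij_betw_def
      by (simp add: image_comp inj_on_imageI)
  next
    fix x y X
    assume xy: "x \<in> arcs (shape P)" "y \<in> arcs (shape P)" "head (shape P) x = head (shape P) y"
      "vtype P (head (shape P) y) = Obj X" "vtype P (tail (shape P) x) \<noteq> Bang"
      "vtype P (tail (shape P) y) \<noteq> Bang"
    obtain k e where e: "e \<in> arcs (shape G)" "x = cE k e" using arcP[OF xy(1)] by blast
    obtain l d where d: "d \<in> arcs (shape G)" "y = cE l d" using arcP[OF xy(2)] by blast
    have h: "head (shape G) e = head (shape G) d" "k = l \<or> \<not> b \<rightarrow>\<^bsub>shape G\<^esub> head (shape G) e"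
      using xy(3) e d cV_eq by auto
    then have "e = d" using wire_in[OF e(1) d(1)] xy e d by simp
    \<comment> \<open>\<open>box_head\<close> read backwards: were the tail in B(b), the wire-vertex
      at the head would be too. So a shared head makes the whole arc shared.\<close>
    moreover have "k = l \<or> \<not> b \<rightarrow>\<^bsub>shape G\<^esub> tail (shape G) e"
      using h box_head[OF _ arrow[OF e(1)] b, of X] xy(4) e d by auto
    ultimately show "x = y" using h e d cE_eq by auto
  next
    fix x y X
    assume xy: "x \<in> arcs (shape P)" "y \<in> arcs (shape P)" "tail (shape P) x = tail (shape P) y"
      "vtype P (tail (shape P) y) = Obj X"
    obtain k e where e: "e \<in> arcs (shape G)" "x = cE k e" using arcP[OF xy(1)] by blast
    obtain l d where d: "d \<in> arcs (shape G)" "y = cE l d" using arcP[OF xy(2)] by blast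
    have h: "tail (shape G) e = tail (shape G) d" "k = l \<or> \<not> b \<rightarrow>\<^bsub>shape G\<^esub> tail (shape G) e"
      using xy(3) e d cV_eq by auto
    then have "e = d" using wire_out[OF e(1) d(1)] xy e d by simp
    \<comment> \<open>\<open>box_tail\<close> does the same with the ends exchanged.\<close>
    moreover have "k = l \<or> \<not> b \<rightarrow>\<^bsub>shape G\<^esub> head (shape G) e"
      using h box_tail[OF _ arrow[OF e(1)] b, of X] xy(4) e d by auto
    ultimately show "x = y" using h e d cE_eq by auto
  next
    fix x y
    assume xy: "x \<in> arcs (shape P)" "y \<in> arcs (shape P)" "tail (shape P) x = tail (shape P) y"
      "head (shape P) x = head (shape P) y" "vtype P (tail (shape P) y) = Bang"
      "vtype P (head (shape P) y) = Bang"
    obtain k e where e: "e \<in> arcs (shape G)" "x = cE k e" using arcP[OF xy(1)] by blast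
    obtain l d where d: "d \<in> arcs (shape G)" "y = cE l d" using arcP[OF xy(2)] by blast
    \<comment> \<open>Both ends are common here, so \<open>cV_eq\<close> alone puts both outside
      B(b) when the copies differ.\<close>
    have "tail (shape G) e = tail (shape G) d" "head (shape G) e = head (shape G) d"
      "k = l \<or> \<not> b \<rightarrow>\<^bsub>shape G\<^esub> tail (shape G) e" "k = l \<or> \<not> b \<rightarrow>\<^bsub>shape G\<^esub> head (shape G) e"
      using xy(3,4) e d cV_eq by auto
    moreover from this have "e = d" using bang_nomulti[OF e(1) d(1)] xy e d by simp
    ultimately show "x = y" using e d cE_eq by auto
  next
    fix x assume "x \<in> verts (shape P)" "vtype P x = Bang"
    then show "x \<rightarrow>\<^bsub>shape P\<^esub> x" using lift bang_refl by (auto simp: P_verts)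
  next
    fix x y assume xy: "x \<rightarrow>\<^bsub>shape P\<^esub> y" "y \<rightarrow>\<^bsub>shape P\<^esub> x" "vtype P x = Bang" "vtype P y = Bang"
    obtain k u v where uv: "x = cV k u" "y = cV k v" "u \<rightarrow>\<^bsub>shape G\<^esub> v" using arrowP[OF xy(1)] by blast
    \<comment> \<open>\<open>box\<close> moves the arrow from \<open>y\<close> to \<open>x\<close>
      into copy \<open>k\<close>, where \<open>v'\<close> must be \<open>v\<close> by injectivity of
      \<open>cV k\<close> on vertices.\<close>
    obtain v' where "y = cV k v'" "v' \<rightarrow>\<^bsub>shape G\<^esub> u" using box xy uv vG by metis
    with uv have "v \<rightarrow>\<^bsub>shape G\<^esub> u" using cV_eq vG by metis
    with uv xy vG show "x = y" using bang_antisym[of u v] by simp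
  next
    fix x y z assume xyz: "x \<rightarrow>\<^bsub>shape P\<^esub> y" "y \<rightarrow>\<^bsub>shape P\<^esub> z" "vtype P x = Bang" "vtype P y = Bang"
    \<comment> \<open>The second arrow fixes the copy \<open>k\<close>, and \<open>box\<close> puts
      \<open>x\<close> there too, so \<open>box_trans\<close> applies within one copy. The two cases
      after this one follow the same pattern.\<close>
    obtain k u v where uv: "y = cV k u" "z = cV k v" "u \<rightarrow>\<^bsub>shape G\<^esub> v" using arrowP[OF xyz(2)] by blast
    obtain u' where "x = cV k u'" "u' \<rightarrow>\<^bsub>shape G\<^esub> u" "vtype G u' = Bang"
      using box xyz uv vG by metis
    then show "x \<rightarrow>\<^bsub>shape P\<^esub> z" using uv box_trans[of u' u v] lift xyz(4) vG by auto
  next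
    fix x y z X
    assume xyz: "x \<rightarrow>\<^bsub>shape P\<^esub> y" "y \<rightarrow>\<^bsub>shape P\<^esub> z" "vtype P x = Bang" "vtype P z = Obj X"
    obtain k u v where uv: "y = cV k u" "z = cV k v" "u \<rightarrow>\<^bsub>shape G\<^esub> v" using arrowP[OF xyz(2)] by blast
    obtain u' where "x = cV k u'" "u' \<rightarrow>\<^bsub>shape G\<^esub> u" "vtype G u' = Bang"
      using box xyz uv vG by metis
    then show "x \<rightarrow>\<^bsub>shape P\<^esub> z" using uv box_head[of u' u v] lift xyz(4) vG by auto
  next
    fix x y z X
    assume xyz: "x \<rightarrow>\<^bsub>shape P\<^esub> y" "z \<rightarrow>\<^bsub>shape P\<^esub> y" "vtype P x = Bang" "vtype P z = Obj X"
    obtain k u v where uv: "z = cV k u" "y = cV k v" "u \<rightarrow>\<^bsub>shape G\<^esub> v" using arrowP[OF xyz(2)] by blast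
    obtain u' where "x = cV k u'" "u' \<rightarrow>\<^bsub>shape G\<^esub> v" "vtype G u' = Bang"
      using box xyz uv vG by metis
    then show "x \<rightarrow>\<^bsub>shape P\<^esub> z" using uv box_tail[of u' v u] lift xyz(4) vG by auto
  next
    fix d x assume d: "d \<in> arcs (shape P)" "fixed_tedge (etype P d)" "vtype P x = Bang"
    obtain k e where e: "e \<in> arcs (shape G)" "d = cE k e" using arcP[OF d(1)] by blast
    \<comment> \<open>Seen from the !-vertex \<open>x\<close>, arrows into copy \<open>k\<close> are
      those of \<open>G\<close>, so \<open>box_fixed\<close> applies to each preimage
      \<open>u\<close> of \<open>x\<close>.\<close>
    have *: "x \<rightarrow>\<^bsub>shape P\<^esub> cV k v \<longleftrightarrow> (\<exists>u. x = cV k u \<and> u \<rightarrow>\<^bsub>shape G\<^esub> v \<and> vtype G u = Bang)"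
      if "v \<in> verts (shape G)" for v
      using box[OF _ d(3) that] lift by blast
    show "x \<rightarrow>\<^bsub>shape P\<^esub> tail (shape P) d \<longleftrightarrow> x \<rightarrow>\<^bsub>shape P\<^esub> head (shape P) d"
      using e d box_fixed[OF e(1)] by (auto simp: *)
  qed
qed

end

section \<open>Classes of the gluing relation, and the three operations\<close>

lemma glue_rel_id_class_eq_iff:
  "glue_rel C id id `` {Inl u} = glue_rel C id id `` {Inl v} \<longleftrightarrow> u = v"
  "glue_rel C id id `` {Inr u} = glue_rel C id id `` {Inr v} \<longleftrightarrow> u = v"
  "glue_rel C id id `` {Inl u} = glue_rel C id id `` {Inr v} \<longleftrightarrow> u = v \<and> u \<in> C"
  "glue_rel C id id `` {Inr u} = glue_rel C id id `` {Inl v} \<longleftrightarrow> u = v \<and> u \<in> C"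
proof -
  let ?R = "glue_rel C id id"
  have eq: "?R `` {x} = ?R `` {y} \<longleftrightarrow> (x, y) \<in> ?R" for x y
    using eq_equiv_class_iff[OF glue_rel_equiv, of x y C id id] by simp
  \<comment> \<open>An invariant that separates the classes: it is constant on each, and two
    distinct elements share a value only if they are \<open>Inl v\<close> and \<open>Inr v\<close>
    with \<open>v \<in> C\<close>.\<close>
  define F where "F = case_sum (\<lambda>v. (v, True)) (\<lambda>v. (v, v \<in> C))"
  have F: "F x = F y" if "(x, y) \<in> ?R" for x y
    using glue_rel_respects[where F = F, OF that] by (auto simp: F_def)
  have glue: "?R `` {Inl v} = ?R `` {Inr v}" if "v \<in> C" for v
    using glue_rel_glue[OF that, of id id] by simp
  show "?R `` {Inl u} = ?R `` {Inl v} \<longleftrightarrow> u = v" "?R `` {Inr u} = ?R `` {Inr v} \<longleftrightarrow> u = v"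
    using F[of "Inl u" "Inl v"] F[of "Inr u" "Inr v"] eq by (auto simp: F_def)
  have LR: "?R `` {Inl u} = ?R `` {Inr v} \<longleftrightarrow> u = v \<and> u \<in> C" for u v
    using F[of "Inl u" "Inr v"] eq glue by (auto simp: F_def)
  show "?R `` {Inl u} = ?R `` {Inr v} \<longleftrightarrow> u = v \<and> u \<in> C" by (rule LR)
  show "?R `` {Inr u} = ?R `` {Inl v} \<longleftrightarrow> u = v \<and> u \<in> C"
    using LR[of v u] by (auto simp del: Image_singleton_iff)
qed

text \<open>The pushout is an instance of \<open>elementary_doubled\<close>:
  \<open>pushout_graph_universal\<close> supplies its typing and the coprojections, and
  \<open>glue_rel_id_class_eq_iff\<close> tells which elements are identified.\<close>

lemma (in elementary_bang_graph) elementary_COPY: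
  assumes b: "vtype G b = Bang"
  shows "elementary_bang_graph T (COPY b G)"
proof -
  define C where "C = remove_verts G (verts (shape (B_graph G b)))"
  define RV where "RV = glue_rel (verts (shape C)) id id"
  define RE where "RE = glue_rel (arcs (shape C)) id id"
  \<comment> \<open>\<open>True\<close> selects the left copy of \<open>G\<close>,
    \<open>False\<close> the right one.\<close>
  define cV where "cV k v = RV `` {if k then Inl v else Inr v}" for k v
  define cE where "cE k e = RE `` {if k then Inl e else Inr e}" for k e
  have C_typed: "typed_over (bang_typegraph T) C" and C_hom: "typed_hom C G id id"
    unfolding C_def remove_verts_def using full_subgraph_typed[OF typed] by blast+
  have CV: "verts (shape C) = {v \<in> verts (shape G). \<not> b \<rightarrow>\<^bsub>shape G\<^esub> v}"
    by (auto simp: C_def remove_verts_def B_graph_def)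
  \<comment> \<open>\<open>C\<close> is a full subgraph, so an arc is glued exactly when both its
    ends are; this gives the clause on both ends in \<open>cE_eq\<close>.\<close>
  have CE: "arcs (shape C) = {e \<in> arcs (shape G).
      \<not> b \<rightarrow>\<^bsub>shape G\<^esub> tail (shape G) e \<and> \<not> b \<rightarrow>\<^bsub>shape G\<^esub> head (shape G) e}"
    using ends by (auto simp: C_def remove_verts_def B_graph_def wf)
  have copy: "COPY b G = pushout_graph C G G id id id id" by (simp add: COPY_def C_def)
  note univ = pushout_graph_universal[OF C_typed typed typed C_hom C_hom]
  show ?thesis
  proof (rule elementary_doubled[OF b, where cV = cV and cE = cE])
    show "typed_over (bang_typegraph T) (COPY b G)" unfolding copy by (rule univ(1))
    show "typed_hom G (COPY b G) (cV k) (cE k)" for k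
      unfolding copy cV_def cE_def RV_def RE_def using univ(2,3) by (cases k) simp_all
    show "verts (shape (COPY b G)) = (\<Union>k. cV k ` verts (shape G))"
      by (auto simp: copy pushout_graph_def Let_def quotient_def cV_def RV_def UNIV_bool)
    show "arcs (shape (COPY b G)) = (\<Union>k. cE k ` arcs (shape G))"
      by (auto simp: copy pushout_graph_def Let_def quotient_def cE_def RE_def UNIV_bool)
    show "cV k u = cV l v \<longleftrightarrow> u = v \<and> (k = l \<or> \<not> b \<rightarrow>\<^bsub>shape G\<^esub> u)"
      if "u \<in> verts (shape G)" "v \<in> verts (shape G)" for k l u v
      using that by (cases k; cases l; auto simp: cV_def RV_def glue_rel_id_class_eq_iff CV)
    show "cE k e = cE l d \<longleftrightarrow> e = d \<and>
        (k = l \<or> \<not> b \<rightarrow>\<^bsub>shape G\<^esub> tail (shape G) e \<and> \<not> b \<rightarrow>\<^bsub>shape G\<^esub> head (shape G) e)"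
      if "e \<in> arcs (shape G)" "d \<in> arcs (shape G)" for k l e d
      using that by (cases k; cases l; auto simp: cE_def RE_def glue_rel_id_class_eq_iff CE)
  qed
qed

theorem theorem4p15:
  fixes T :: "('o, 'm) signature"
    and G :: "('v, 'e, 'o, 'm) typed_graph"
    and b :: 'v
  assumes "compressed_signature T"
    and "bang_graph T G"
    and "b \<in> bang_verts G"
  shows "bang_graph T (COPY b G) \<and> bang_graph T (DROP b G) \<and> bang_graph T (KILL b G)"
proof -
  interpret elementary_bang_graph T G using assms(2) bang_graph_iff_elementary by blast
  have b: "vtype G b = Bang" using assms(3) by (simp add: bang_verts_def)
  have "elementary_bang_graph T (DROP b G)"
    unfolding DROP_def remove_verts_def
    \<comment> \<open>Neither end of a fixed-arity arc is the !-vertex \<open>b\<close>.\<close>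
    by (rule elementary_full_subgraph) (use ends typed_over_bang_fixed[OF typed] b in auto)
  moreover have "elementary_bang_graph T (KILL b G)"
    unfolding KILL_def remove_verts_def
    \<comment> \<open>By \<open>box_fixed\<close> the complement of B(b) contains both ends of a
      fixed-arity arc or neither.\<close>
    by (rule elementary_full_subgraph) (use ends box_fixed b in \<open>auto simp: B_graph_def\<close>)
  ultimately show ?thesis
    using elementary_COPY[OF b] by (simp add: bang_graph_iff_elementary)
qed

end
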